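(* Let $(X,d)$ be a compact metric space, $f:X\to X$ a homeomorphism, and $\pi_0$ a Borel probability measure on $X$. Assume that $\pi_0$ is $f$-invariant and that $h_{\mathrm{top}}(f;\operatorname{supp}\pi_0)<\infty$. Let $C_0$ be the smallest channel capacity above which the eventual almost sure estimation objective (E1) can be achieved for every $\varepsilon>0$. Then $$h_{\mathrm{top}}(f;\operatorname{supp}\pi_0)\ \le\ C_0\ \le\ \log\bigl(1+\lfloor 2^{h_{\mathrm{top}}(f;\operatorname{supp}\pi_0)}\rfloor\bigr).$$
   Context: All logarithms are to base $2$. The system is $x_{t+1}=f(x_t)$ with random initial state $x_0$ distributed according to $\pi_0$; $\operatorname{supp}\pi_0$ is the support of $\pi_0$. Policies: given a finite nonempty alphabet $\mathcal{M}$ (noiseless channel of capacity $C=\log|\mathcal{M}|$), a coding and estimation policy consists of measurable maps $\delta_t:X^{t+1}\to\mathcal{M}$ and maps $\gamma_t:\mathcal{M}^{t+1}\to X$, $t=0,1,2,\dots$. For initial state $x_0$, put $x_t=f^t(x_0)$, $q_t=\delta_t(x_0,x_1,\dots,x_t)$ and $\hat{x}_t=\hat{x}_t(x_0)=\gamma_t(q_0,q_1,\dots,q_t)$. Objective (E1) for a given $\varepsilon>0$: there exists $T=T(\varepsilon)\in\mathbb{N}$ such that $\pi_0(\{x_0\in X: d(f^t(x_0),\hat{x}_t(x_0))\le\varepsilon\})=1$ for all $t\ge T$. $C_0$: for $\varepsilon>0$ let $C_\varepsilon$ be the infimum of $\log|\mathcal{M}|$ over all finite alphabets $\mathcal{M}$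 for which there is a coding and estimation policy achieving the objective for this $\varepsilon$ (with $\inf\emptyset=\infty$); then $C_0:=\lim_{\varepsilon\downarrow0}C_\varepsilon$. Topological entropy on a compact set $K\subset X$: for $n\in\mathbb{N}$, $\varepsilon>0$, a set $F\subset X$ $(n,\varepsilon)$-spans $K$ if for each $x\in K$ there is $y\in F$ with $d(f^i(x),f^i(y))\le\varepsilon$ for $0\le i<n$. Let $r_{\mathrm{span}}(n,\varepsilon;K)$ be the minimal cardinality of such a set, and $h_{\mathrm{top}}(f;K):=\lim_{\varepsilon\downarrow0}\limsup_{n\to\infty}\frac1n\log r_{\mathrm{span}}(n,\varepsilon;K)$. *)

theory Defs
  imports "HOL-Probability.Probability"
begin

section \<open>Support of a Borel measure\<close>

definition measure_support :: "'a::topological_space measure \<Rightarrow> 'a set" where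
  "measure_support \<mu> = {x. \<forall>U. open U \<longrightarrow> x \<in> U \<longrightarrow> emeasure \<mu> U > 0}"

section \<open>Topological entropy on a compact set\<close>

definition spans :: "('a::metric_space \<Rightarrow> 'a) \<Rightarrow> nat \<Rightarrow> real \<Rightarrow> 'a set \<Rightarrow> 'a set \<Rightarrow> bool" where
  "spans f n \<epsilon> K F \<longleftrightarrow> (\<forall>x\<in>K. \<exists>y\<in>F. \<forall>i<n. dist ((f ^^ i) x) ((f ^^ i) y) \<le> \<epsilon>)"

text \<open>
  The minimum is taken over finite spanning sets only; one exists whenever \<open>f\<close> is continuous,
  \<open>K\<close> is compact and \<open>\<epsilon> > 0\<close> (lemma \<open>finite_spanning_set_exists\<close>).
\<close>

definition r_span :: "('a::metric_space \<Rightarrow> 'a) \<Rightarrow> nat \<Rightarrow> real \<Rightarrow> 'a set \<Rightarrow> nat" where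
  "r_span f n \<epsilon> K = (LEAST k. \<exists>F. finite F \<and> card F = k \<and> spans f n \<epsilon> K F)"

definition span_growth :: "('a::metric_space \<Rightarrow> 'a) \<Rightarrow> 'a set \<Rightarrow> real \<Rightarrow> ereal" where
  "span_growth f K \<epsilon> = limsup (\<lambda>n. ereal (1 / real n * log 2 (real (r_span f n \<epsilon> K))))"

definition h_top :: "('a::metric_space \<Rightarrow> 'a) \<Rightarrow> 'a set \<Rightarrow> ereal" where
  "h_top f K = Lim (at_right 0) (span_growth f K)"

section \<open>Coding and estimation policies\<close>

text \<open>
  Alphabets are finite nonempty sets of natural numbers; only their cardinality matters.
  Elements of \<open>X\<^sup>t\<^sup>+\<^sup>1\<close> and \<open>M\<^sup>t\<^sup>+\<^sup>1\<close> are extensional functions on \<open>{..t}\<close>. No condition is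
  imposed on the estimator maps \<open>\<gamma>\<^sub>t\<close>, whose values outside \<open>M\<^sup>t\<^sup>+\<^sup>1\<close> are never used.
\<close>

definition coder :: "nat set \<Rightarrow> (nat \<Rightarrow> (nat \<Rightarrow> 'a::topological_space) \<Rightarrow> nat) \<Rightarrow> bool" where
  "coder M \<delta> \<longleftrightarrow> (\<forall>t. \<delta> t \<in> (\<Pi>\<^sub>M i\<in>{..t}. borel) \<rightarrow>\<^sub>M count_space M)"

definition channel_symbol ::
  "('a \<Rightarrow> 'a) \<Rightarrow> (nat \<Rightarrow> (nat \<Rightarrow> 'a) \<Rightarrow> nat) \<Rightarrow> 'a \<Rightarrow> nat \<Rightarrow> nat" where
  "channel_symbol f \<delta> x\<^sub>0 t = \<delta> t (\<lambda>i\<in>{..t}. (f ^^ i) x\<^sub>0)"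

definition state_estimate ::
  "('a \<Rightarrow> 'a) \<Rightarrow> (nat \<Rightarrow> (nat \<Rightarrow> 'a) \<Rightarrow> nat) \<Rightarrow> (nat \<Rightarrow> (nat \<Rightarrow> nat) \<Rightarrow> 'a) \<Rightarrow> 'a \<Rightarrow> nat \<Rightarrow> 'a" where
  "state_estimate f \<delta> \<gamma> x\<^sub>0 t = \<gamma> t (\<lambda>i\<in>{..t}. channel_symbol f \<delta> x\<^sub>0 i)"

definition achieves_E1 ::
  "('a::metric_space \<Rightarrow> 'a) \<Rightarrow> 'a measure \<Rightarrow> real \<Rightarrow> (nat \<Rightarrow> (nat \<Rightarrow> 'a) \<Rightarrow> nat) \<Rightarrow>
    (nat \<Rightarrow> (nat \<Rightarrow> nat) \<Rightarrow> 'a) \<Rightarrow> bool" where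
  "achieves_E1 f \<pi>\<^sub>0 \<epsilon> \<delta> \<gamma> \<longleftrightarrow>
    (\<exists>T. \<forall>t\<ge>T. measure \<pi>\<^sub>0 {x\<^sub>0. dist ((f ^^ t) x\<^sub>0) (state_estimate f \<delta> \<gamma> x\<^sub>0 t) \<le> \<epsilon>} = 1)"

definition achievable_alphabets ::
  "('a::metric_space \<Rightarrow> 'a) \<Rightarrow> 'a measure \<Rightarrow> real \<Rightarrow> nat set set" where
  "achievable_alphabets f \<pi>\<^sub>0 \<epsilon> =
    {M. finite M \<and> M \<noteq> {} \<and> (\<exists>\<delta> \<gamma>. coder M \<delta> \<and> achieves_E1 f \<pi>\<^sub>0 \<epsilon> \<delta> \<gamma>)}"

definition C_eps :: "('a::metric_space \<Rightarrow> 'a) \<Rightarrow> 'a measure \<Rightarrow> real \<Rightarrow> ereal" where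
  "C_eps f \<pi>\<^sub>0 \<epsilon> = (INF M\<in>achievable_alphabets f \<pi>\<^sub>0 \<epsilon>. ereal (log 2 (real (card M))))"

definition C_zero :: "('a::metric_space \<Rightarrow> 'a) \<Rightarrow> 'a measure \<Rightarrow> ereal" where
  "C_zero f \<pi>\<^sub>0 = Lim (at_right 0) (C_eps f \<pi>\<^sub>0)"

section \<open>Existence of the limits\<close>

lemma antimono_tendsto_at_right:
  fixes g :: "real \<Rightarrow> ereal"
  assumes "\<And>a b. 0 < a \<Longrightarrow> a \<le> b \<Longrightarrow> g b \<le> g a"
  shows "(g \<longlongrightarrow> (SUP \<epsilon>\<in>{0<..}. g \<epsilon>)) (at_right 0)"
proof (rule increasing_tendsto)
  show "\<forall>\<^sub>F \<epsilon> in at_right 0. g \<epsilon> \<le> (SUP \<epsilon>\<in>{0<..}. g \<epsilon>)"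
    using eventually_at_right_less[of 0] by eventually_elim (auto intro: SUP_upper)
next
  fix y assume "y < (SUP \<epsilon>\<in>{0<..}. g \<epsilon>)"
  then obtain a where a: "0 < a" "y < g a"
    by (auto simp: less_SUP_iff)
  have "\<forall>\<^sub>F \<epsilon> in at_right 0. \<epsilon> \<in> {0<..<a}"
    using a(1) by (rule eventually_at_right_real)
  then show "\<forall>\<^sub>F \<epsilon> in at_right 0. y < g \<epsilon>"
    by eventually_elim (use a assms in \<open>force intro: less_le_trans\<close>)
qed

lemma continuous_on_funpow:
  fixes f :: "'a::topological_space \<Rightarrow> 'a"
  assumes "continuous_on UNIV f"
  shows "continuous_on UNIV (f ^^ i)"
proof (induction i)
  case 0
  then show ?case by (simp add: id_def)
next
  case (Suc i)
  then show ?case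
    using continuous_on_compose[of UNIV "f ^^ i" f] assms continuous_on_subset
    by (auto simp: o_def)
qed

lemma finite_spanning_set_exists:
  fixes f :: "'a::metric_space \<Rightarrow> 'a"
  assumes f: "continuous_on UNIV f" and K: "compact K" and \<epsilon>: "\<epsilon> > 0"
  shows "\<exists>F. finite F \<and> spans f n \<epsilon> K F"
proof -
  define B where "B y = (\<Inter>i\<in>{..<n}. (f ^^ i) -` ball ((f ^^ i) y) \<epsilon>)" for y
  have op: "open (B y)" for y
    unfolding B_def by (intro open_INT finite_lessThan ballI open_vimage open_ball
      continuous_on_funpow f)
  have cov: "K \<subseteq> (\<Union>y\<in>K. B y)"
    using \<epsilon> by (auto simp: B_def)
  obtain F where F: "F \<subseteq> K" "finite F" "K \<subseteq> (\<Union>y\<in>F. B y)"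
    by (rule compactE_image[OF K _ cov]) (use op in auto)
  have "spans f n \<epsilon> K F"
    unfolding spans_def
  proof
    fix x assume "x \<in> K"
    then obtain y where "y \<in> F" "x \<in> B y" using F by blast
    then show "\<exists>y\<in>F. \<forall>i<n. dist ((f ^^ i) x) ((f ^^ i) y) \<le> \<epsilon>"
      by (intro bexI[of _ y]) (auto simp: B_def dist_commute less_imp_le)
  qed
  with F show ?thesis by blast
qed

lemma r_span_attained:
  fixes f :: "'a::metric_space \<Rightarrow> 'a"
  assumes "continuous_on UNIV f" "compact K" "\<epsilon> > 0"
  shows "\<exists>F. finite F \<and> card F = r_span f n \<epsilon> K \<and> spans f n \<epsilon> K F"
  unfolding r_span_def
  by (rule LeastI_ex) (use finite_spanning_set_exists[OF assms, of n] in blast)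

lemma r_span_le: "finite F \<Longrightarrow> spans f n \<epsilon> K F \<Longrightarrow> r_span f n \<epsilon> K \<le> card F"
  unfolding r_span_def by (rule Least_le) blast

lemma span_growth_antimono:
  fixes f :: "'a::metric_space \<Rightarrow> 'a"
  assumes "continuous_on UNIV f" "compact K" "0 < a" "a \<le> b"
  shows "span_growth f K b \<le> span_growth f K a"
proof (cases "K = {}")
  case True
  have "r_span f n e K \<le> card ({} :: 'a set)" for n e
    by (rule r_span_le) (auto simp: spans_def True)
  then have "r_span f n e K = 0" for n e
    by (metis card.empty le_zero_eq)
  then show ?thesis by (simp add: span_growth_def)
next
  case False
  have le: "r_span f n b K \<le> r_span f n a K" for n
  proof -
    obtain F where F: "finite F" "card F = r_span f n a K" "spans f n a K F"
      using r_span_attained[OF assms(1-3), of n] by blast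
    then have "spans f n b K F"
      using \<open>a \<le> b\<close> unfolding spans_def by (meson order_trans)
    then show ?thesis using r_span_le F by metis
  qed
  have pos: "r_span f n b K > 0" for n
  proof -
    obtain F where F: "finite F" "card F = r_span f n b K" "spans f n b K F"
      using r_span_attained[OF assms(1,2), of b n] assms(3,4) by auto
    then have "F \<noteq> {}" using False by (auto simp: spans_def)
    then show ?thesis using F by (metis card_gt_0_iff)
  qed
  have "1 / real n * log 2 (real (r_span f n b K)) \<le> 1 / real n * log 2 (real (r_span f n a K))"
    for n using le[of n] pos[of n] by (intro mult_left_mono) auto
  then show ?thesis
    unfolding span_growth_def by (intro Limsup_mono always_eventually) simp
qed

lemma h_top_limit:
  fixes f :: "'a::metric_space \<Rightarrow> 'a"
  assumes "continuous_on UNIV f" "compact K"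
  shows "(span_growth f K \<longlongrightarrow> h_top f K) (at_right 0)"
proof -
  have "(span_growth f K \<longlongrightarrow> (SUP \<epsilon>\<in>{0<..}. span_growth f K \<epsilon>)) (at_right 0)"
    by (rule antimono_tendsto_at_right) (rule span_growth_antimono[OF assms])
  then show ?thesis
    unfolding h_top_def using tendsto_Lim[OF trivial_limit_at_right_real] by metis
qed

lemma channel_symbol_measurable:
  fixes f :: "'a::topological_space \<Rightarrow> 'a"
  assumes "continuous_on UNIV f" "coder M \<delta>"
  shows "(\<lambda>x. channel_symbol f \<delta> x t) \<in> borel \<rightarrow>\<^sub>M count_space M"
proof -
  have "(\<lambda>x. \<lambda>i\<in>{..t}. (f ^^ i) x) \<in> borel \<rightarrow>\<^sub>M (\<Pi>\<^sub>M i\<in>{..t}. borel)"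
    by (intro measurable_restrict borel_measurable_continuous_onI
      continuous_on_funpow[OF assms(1)])
  from measurable_compose[OF this] assms(2) show ?thesis
    unfolding coder_def channel_symbol_def by blast
qed

lemma E1_set_measurable:
  fixes f :: "'a::metric_space \<Rightarrow> 'a"
  assumes f: "continuous_on UNIV f" and M: "finite M" and \<delta>: "coder M \<delta>"
  shows "{x. dist ((f ^^ t) x) (state_estimate f \<delta> \<gamma> x t) \<le> \<epsilon>} \<in> sets borel"
proof -
  define q where "q x = (\<lambda>i\<in>{..t}. channel_symbol f \<delta> x i)" for x
  let ?W = "PiE {..t} (\<lambda>_. M)"
  have qW: "q x \<in> ?W" for x
    using measurable_space[OF channel_symbol_measurable[OF f \<delta>]] by (auto simp: q_def)
  have lvl: "{x. q x = w} \<in> sets borel" if "w \<in> ?W" for w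
  proof -
    have "{x. q x = w} = (\<Inter>i\<in>{..t}. {x. channel_symbol f \<delta> x i = w i})"
      using that by (auto simp: q_def fun_eq_iff PiE_def extensional_def)
    moreover have "{x. channel_symbol f \<delta> x i = w i} \<in> sets borel" if "i \<in> {..t}" for i
    proof -
      have "{w i} \<in> sets (count_space M)" using \<open>w \<in> ?W\<close> that by auto
      from measurable_sets[OF channel_symbol_measurable[OF f \<delta>, of i] this]
      show ?thesis by (simp add: vimage_def)
    qed
    ultimately show ?thesis by (auto intro!: sets.finite_INT)
  qed
  have "{x. dist ((f ^^ t) x) (state_estimate f \<delta> \<gamma> x t) \<le> \<epsilon>} =
      (\<Union>w\<in>?W. {x. q x = w} \<inter> {x. dist ((f ^^ t) x) (\<gamma> t w) \<le> \<epsilon>})"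
    using qW by (auto simp: state_estimate_def q_def)
  moreover have "{x. dist ((f ^^ t) x) y \<le> \<epsilon>} \<in> sets borel" for y
    by (intro borel_closed closed_Collect_le continuous_intros continuous_on_funpow f)
  ultimately show ?thesis
    using lvl M by (auto intro!: sets.finite_UN finite_PiE)
qed

lemma C_eps_antimono:
  fixes f :: "'a::metric_space \<Rightarrow> 'a"
  assumes f: "continuous_on UNIV f" and p: "prob_space \<pi>\<^sub>0" "sets \<pi>\<^sub>0 = sets borel"
    and le: "a \<le> b"
  shows "C_eps f \<pi>\<^sub>0 b \<le> C_eps f \<pi>\<^sub>0 a"
proof -
  interpret prob_space \<pi>\<^sub>0 by fact
  have "M \<in> achievable_alphabets f \<pi>\<^sub>0 b" if M: "M \<in> achievable_alphabets f \<pi>\<^sub>0 a" for M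
  proof -
    obtain \<delta> \<gamma> T where *: "finite M" "M \<noteq> {}" "coder M \<delta>"
      "\<And>t. t \<ge> T \<Longrightarrow> measure \<pi>\<^sub>0 {x. dist ((f ^^ t) x) (state_estimate f \<delta> \<gamma> x t) \<le> a} = 1"
      using M unfolding achievable_alphabets_def achieves_E1_def by blast
    have "measure \<pi>\<^sub>0 {x. dist ((f ^^ t) x) (state_estimate f \<delta> \<gamma> x t) \<le> b} = 1" if "t \<ge> T" for t
    proof (rule antisym)
      show "1 \<le> measure \<pi>\<^sub>0 {x. dist ((f ^^ t) x) (state_estimate f \<delta> \<gamma> x t) \<le> b}"
        unfolding *(4)[OF that, symmetric]
        by (rule finite_measure_mono)
          (use le E1_set_measurable[OF f *(1,3)] p(2) in auto)
    qed simp
    then show ?thesis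
      using * unfolding achievable_alphabets_def achieves_E1_def by blast
  qed
  then show ?thesis
    unfolding C_eps_def by (intro INF_superset_mono) auto
qed

lemma C_zero_limit:
  fixes f :: "'a::metric_space \<Rightarrow> 'a"
  assumes "continuous_on UNIV f" "prob_space \<pi>\<^sub>0" "sets \<pi>\<^sub>0 = sets borel"
  shows "(C_eps f \<pi>\<^sub>0 \<longlongrightarrow> C_zero f \<pi>\<^sub>0) (at_right 0)"
proof -
  have "(C_eps f \<pi>\<^sub>0 \<longlongrightarrow> (SUP \<epsilon>\<in>{0<..}. C_eps f \<pi>\<^sub>0 \<epsilon>)) (at_right 0)"
    by (rule antimono_tendsto_at_right) (rule C_eps_antimono[OF assms])
  then show ?thesis
    unfolding C_zero_def using tendsto_Lim[OF trivial_limit_at_right_real] by metis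
qed

end

theory Submission
  imports Defs "HOL-Real_Asymp.Real_Asymp"
begin

text \<open>
  Lower bound: the channel words up to time \<open>T + n\<close> take at most \<open>|M|^(T + n)\<close> values, and two
  generic initial states with the same word stay \<open>2\<epsilon>\<close>-close during \<open>{T..<T + n}\<close>. Invariance
  makes the images under \<open>f^T\<close> of the generic states dense in the support, so one representative
  per word yields a spanning set.

  Upper bound: if \<open>log N\<close> exceeds the entropy, some \<open>n\<close> admits an \<open>(n, \<epsilon>)\<close>-spanning set of the
  support with at most \<open>N^n\<close> points. As the system is deterministic, during each block of length
  \<open>n\<close> the coder can spell out the spanning point that shadows the orbit in the \<^emph>\<open>next\<close> block.
\<close>

section \<open>The support\<close>

lemma Compl_measure_support:
  "- measure_support \<mu> = \<Union>{U. open U \<and> emeasure \<mu> U = 0}"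
  unfolding measure_support_def by (auto simp: zero_less_iff_neq_zero)

lemma closed_measure_support: "closed (measure_support \<mu>)"
  unfolding closed_def Compl_measure_support by blast

text \<open>Compactness replaces the possibly uncountable cover of \<open>C\<close> by null open
  sets with a finite one, whose union is null.\<close>

lemma null_sets_compact_disjoint_support:
  assumes C: "compact C" "C \<inter> measure_support \<mu> = {}" "C \<in> sets \<mu>"
    and \<mu>: "sets \<mu> = sets borel"
  shows "C \<in> null_sets \<mu>"
proof -
  have "C \<subseteq> \<Union>{U. open U \<and> emeasure \<mu> U = 0}"
    using C(2) Compl_measure_support[of \<mu>] by blast
  then obtain D where D: "D \<subseteq> {U. open U \<and> emeasure \<mu> U = 0}" "finite D" "C \<subseteq> \<Union>D"
    using compactE[OF C(1)] by (metis (no_types, lifting) mem_Collect_eq)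
  have "(\<Union>U\<in>D. U) \<in> null_sets \<mu>"
    using D(1,2) \<mu> by (intro null_sets_UN') (auto simp: countable_finite null_sets_def subset_iff)
  then have "\<Union>D \<in> null_sets \<mu>"
    by simp
  then show ?thesis
    using D(3) C(3) null_sets_subset by blast
qed

text \<open>The complement of the closed support is exhausted by the compact sets \<open>C n\<close>
  of points at distance at least \<open>1 / Suc n\<close> from every point of the support. Each of
  them is null, and there are countably many.\<close>

lemma AE_measure_support:
  fixes \<mu> :: "'a::metric_space measure"
  assumes X: "compact (UNIV :: 'a set)" and \<mu>: "sets \<mu> = sets borel"
  shows "AE x in \<mu>. x \<in> measure_support \<mu>"
proof -
  let ?K = "measure_support \<mu>"
  define C where "C n = (\<Inter>y\<in>?K. {x. 1 / real (Suc n) \<le> dist x y})" for n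
  have cl: "closed (C n)" for n
    unfolding C_def by (intro closed_INT ballI closed_Collect_le continuous_intros)
  have "C n \<in> null_sets \<mu>" for n
  proof (rule null_sets_compact_disjoint_support)
    show "compact (C n)"
      using compact_Int_closed[OF X cl] by simp
    show "C n \<inter> ?K = {}"
    proof -
      have False if "x \<in> C n" "x \<in> ?K" for x
      proof -
        have "1 / real (Suc n) \<le> dist x x"
          using that unfolding C_def by blast
        then show False by simp
      qed
      then show ?thesis by blast
    qed
    show "C n \<in> sets \<mu>"
      using cl \<mu> by simp
  qed fact
  then have "(\<Union>n. C n) \<in> null_sets \<mu>"
    by auto
  moreover have "- ?K \<subseteq> (\<Union>n. C n)"
  proof
    fix x assume "x \<in> - ?K"
    then obtain e where e: "e > 0" "ball x e \<subseteq> - ?K"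
      using closed_measure_support openE unfolding closed_def by metis
    obtain n where "inverse (real (Suc n)) < e"
      using reals_Archimedean[OF e(1)] by blast
    then have "ball x (1 / real (Suc n)) \<subseteq> - ?K"
      using subset_ball[of "1 / real (Suc n)" e x] e(2) by (simp add: inverse_eq_divide)
    then have "x \<in> C n"
      unfolding C_def by (auto simp: not_less[symmetric])
    then show "x \<in> (\<Union>n. C n)" by blast
  qed
  ultimately show ?thesis
    by (auto intro!: AE_I'[of "\<Union>n. C n"])
qed

text \<open>The complement of the closure is an open null set, so it contains no point of the
  support. This is how a property of generic points reaches the whole support.\<close>

lemma measure_support_subset_closure:
  assumes P: "AE x in \<mu>. P x" and \<mu>: "sets \<mu> = sets borel"
  shows "measure_support \<mu> \<subseteq> closure {x. P x}"
proof
  fix y assume y: "y \<in> measure_support \<mu>"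
  show "y \<in> closure {x. P x}"
  proof (rule ccontr)
    let ?U = "- closure {x. P x}"
    assume "y \<notin> closure {x. P x}"
    moreover have "AE x in \<mu>. x \<notin> ?U"
      using P by eventually_elim (metis ComplD closure_subset mem_Collect_eq subsetD)
    then have "emeasure \<mu> ?U = 0"
      using \<mu> by (subst AE_iff_measurable[symmetric, where P="\<lambda>x. x \<notin> ?U"])
        (auto simp: sets_eq_imp_space_eq[OF \<mu>])
    ultimately show False
      using y unfolding measure_support_def by (auto dest!: spec[of _ ?U])
  qed
qed

lemma distr_funpow_invariant:
  assumes f: "f \<in> borel \<rightarrow>\<^sub>M borel" and \<mu>: "sets \<mu> = sets borel" and inv: "distr \<mu> borel f = \<mu>"
  shows "distr \<mu> borel (f ^^ n) = \<mu>"
proof (induction n)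
  case 0
  then show ?case
    using \<mu> by (auto simp: id_def intro: distr_id2)
next
  case (Suc n)
  have "f ^^ n \<in> borel \<rightarrow>\<^sub>M borel"
    using f by (rule measurable_compose_n)
  then have "distr \<mu> borel (f ^^ Suc n) = distr (distr \<mu> borel (f ^^ n)) borel f"
    using f \<mu> by (subst distr_distr) (auto cong: measurable_cong_sets)
  then show ?case
    using Suc.IH inv by (simp only:)
qed

section \<open>Lower bound\<close>

text \<open>A finite union of closed Bowen balls. Closedness serves twice: spanning passes to
  closures, and a single Bowen ball is Borel, as measurability of the coder requires.\<close>

lemma closed_shadowed_set:
  fixes f :: "'a::metric_space \<Rightarrow> 'a"
  assumes "continuous_on UNIV f" "finite F"
  shows "closed {x. \<exists>y\<in>F. \<forall>i<n. dist ((f ^^ i) x) ((f ^^ i) y) \<le> \<epsilon>}"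
proof -
  have "{x. \<exists>y\<in>F. \<forall>i<n. dist ((f ^^ i) x) ((f ^^ i) y) \<le> \<epsilon>} =
      (\<Union>y\<in>F. \<Inter>i\<in>{..<n}. {x. dist ((f ^^ i) x) ((f ^^ i) y) \<le> \<epsilon>})"
    by auto
  then show ?thesis
    using assms
    by (auto intro!: closed_UN closed_INT closed_Collect_le continuous_intros continuous_on_funpow)
qed

lemma spans_closure:
  fixes f :: "'a::metric_space \<Rightarrow> 'a"
  assumes "continuous_on UNIV f" "finite F" "spans f n \<epsilon> A F"
  shows "spans f n \<epsilon> (closure A) F"
  using closure_minimal[OF _ closed_shadowed_set[OF assms(1,2)], of A n \<epsilon>] assms(3)
  unfolding spans_def by blast

lemma spans_subset: "spans f n \<epsilon> B F \<Longrightarrow> A \<subseteq> B \<Longrightarrow> spans f n \<epsilon> A F"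
  unfolding spans_def by blast

lemma r_span_pos:
  fixes f :: "'a::metric_space \<Rightarrow> 'a"
  assumes "continuous_on UNIV f" "compact K" "\<epsilon> > 0" "K \<noteq> {}"
  shows "r_span f n \<epsilon> K > 0"
proof -
  obtain F where F: "finite F" "card F = r_span f n \<epsilon> K" "spans f n \<epsilon> K F"
    using r_span_attained[OF assms(1-3), of n] by blast
  then have "F \<noteq> {}"
    using assms(4) by (auto simp: spans_def)
  then show ?thesis
    using F by (metis card_gt_0_iff)
qed

text \<open>One point is picked per value of \<open>q\<close>. The representatives lie in
  \<open>A\<close> itself; in the application the estimates are accurate for them too.\<close>

lemma finite_representatives:
  assumes "finite W" "q ` A \<subseteq> W"
  obtains R where "R \<subseteq> A" "finite R" "card R \<le> card W" "\<And>x. x \<in> A \<Longrightarrow> \<exists>r\<in>R. q r = q x"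
proof
  let ?R = "inv_into A q ` q ` A"
  have fin: "finite (q ` A)"
    using assms finite_subset by blast
  show "?R \<subseteq> A"
    by (auto intro: inv_into_into)
  show "finite ?R"
    using fin by simp
  show "card ?R \<le> card W"
    using card_image_le[OF fin] card_mono[OF assms] order_trans by blast
  show "\<exists>r\<in>?R. q r = q x" if "x \<in> A" for x
    using that by (auto simp: f_inv_into_f)
qed

text \<open>Accuracy is only guaranteed from time \<open>T\<close> on, so orbits are compared after
  a shift by \<open>T\<close>. The exponent counts the \<open>T\<close> symbols sent before that as
  well.\<close>

lemma r_span_le_words:
  fixes f :: "'a::metric_space \<Rightarrow> 'a"
  assumes f: "continuous_on UNIV f" and p: "prob_space \<pi>\<^sub>0" and s: "sets \<pi>\<^sub>0 = sets borel"
    and inv: "distr \<pi>\<^sub>0 borel f = \<pi>\<^sub>0"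
    and M: "finite M" and \<delta>: "coder M \<delta>"
    and E1: "\<And>t. t \<ge> T \<Longrightarrow>
      measure \<pi>\<^sub>0 {x. dist ((f ^^ t) x) (state_estimate f \<delta> \<gamma> x t) \<le> \<epsilon>} = 1"
  shows "r_span f n (2 * \<epsilon>) (measure_support \<pi>\<^sub>0) \<le> card M ^ (T + n)"
proof -
  interpret prob_space \<pi>\<^sub>0 by fact
  have fm: "f \<in> borel \<rightarrow>\<^sub>M borel"
    using f by (rule borel_measurable_continuous_onI)
  \<comment> \<open>Accuracy at all times from \<open>T\<close> on simultaneously: a countable
    intersection of almost sure events.\<close>
  define good where
    "good = {x. \<forall>t\<ge>T. dist ((f ^^ t) x) (state_estimate f \<delta> \<gamma> x t) \<le> \<epsilon>}"
  define q where "q x = (\<lambda>i\<in>{..<T + n}. channel_symbol f \<delta> x i)" for x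
  let ?W = "PiE {..<T + n} (\<lambda>_. M)"
  have ae: "AE x in \<pi>\<^sub>0. x \<in> good"
  proof -
    have "AE x in \<pi>\<^sub>0. dist ((f ^^ t) x) (state_estimate f \<delta> \<gamma> x t) \<le> \<epsilon>" if "t \<ge> T" for t
      using AE_prob_1[OF E1[OF that]] by simp
    then show ?thesis
      unfolding good_def by (simp add: AE_all_countable)
  qed
  have qW: "q ` good \<subseteq> ?W"
    using measurable_space[OF channel_symbol_measurable[OF f \<delta>], simplified]
    unfolding q_def by (intro image_subsetI restrict_PiE_iff[THEN iffD2]) auto
  obtain R where R: "R \<subseteq> good" "finite R" "card R \<le> card ?W"
    "\<And>x. x \<in> good \<Longrightarrow> \<exists>r\<in>R. q r = q x"
    using finite_representatives[OF finite_PiE qW] M by blast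
  let ?F = "(f ^^ T) ` R"
  have sp1: "spans f n (2 * \<epsilon>) ((f ^^ T) ` good) ?F"
    unfolding spans_def
  proof (rule ballI)
    fix z assume "z \<in> (f ^^ T) ` good"
    then obtain x where x: "x \<in> good" "z = (f ^^ T) x" by blast
    then obtain r where r: "r \<in> R" "q r = q x" using R(4) by blast
    have "dist ((f ^^ i) z) ((f ^^ i) ((f ^^ T) r)) \<le> 2 * \<epsilon>" if "i < n" for i
    proof -
      \<comment> \<open>Time \<open>i\<close> along \<open>z\<close> is time \<open>i + T\<close>
        along \<open>x\<close>. As \<open>i < n\<close>, the common word \<open>q r = q x\<close>
        covers every symbol entering the estimate at \<open>?t\<close>, so \<open>r\<close> and
        \<open>x\<close> receive the same estimate.\<close>
      let ?t = "i + T"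
      have "channel_symbol f \<delta> r k = channel_symbol f \<delta> x k" if "k \<le> ?t" for k
        using fun_cong[OF r(2), of k] that \<open>i < n\<close> by (simp add: q_def)
      then have eq: "state_estimate f \<delta> \<gamma> r ?t = state_estimate f \<delta> \<gamma> x ?t"
        unfolding state_estimate_def by (intro arg_cong[where f="\<gamma> ?t"] restrict_ext) auto
      have "dist ((f ^^ ?t) x) (state_estimate f \<delta> \<gamma> x ?t) \<le> \<epsilon>"
        using x(1) unfolding good_def by simp
      moreover have "dist ((f ^^ ?t) r) (state_estimate f \<delta> \<gamma> x ?t) \<le> \<epsilon>"
        using subsetD[OF R(1) r(1)] unfolding good_def eq[symmetric] by simp
      ultimately have "dist ((f ^^ ?t) x) ((f ^^ ?t) r) \<le> \<epsilon> + \<epsilon>"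
        using dist_triangle2[of "(f ^^ ?t) x" "(f ^^ ?t) r" "state_estimate f \<delta> \<gamma> x ?t"]
        by linarith
      then show ?thesis
        by (simp add: x(2) funpow_add)
    qed
    then show "\<exists>y\<in>?F. \<forall>i<n. dist ((f ^^ i) z) ((f ^^ i) y) \<le> 2 * \<epsilon>"
      using r(1) by blast
  qed
  have "measure_support \<pi>\<^sub>0 \<subseteq> closure ((f ^^ T) ` good)"
  proof -
    let ?Z = "closure ((f ^^ T) ` good)"
    have fT: "f ^^ T \<in> \<pi>\<^sub>0 \<rightarrow>\<^sub>M borel"
      using measurable_compose_n[OF fm, of T] s by (simp cong: measurable_cong_sets)
    \<comment> \<open>The closure is Borel, whereas the image of \<open>good\<close> under
      \<open>f ^^ T\<close> need not be; a measurable set is required to pass to the image measure,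
      which is \<pi> itself by invariance.\<close>
    have "AE x in \<pi>\<^sub>0. (f ^^ T) x \<in> ?Z"
      using ae by eventually_elim (rule subsetD[OF closure_subset imageI])
    then have "AE z in distr \<pi>\<^sub>0 borel (f ^^ T). z \<in> ?Z"
      by (subst AE_distr_iff[OF fT]) simp_all
    then have "AE z in \<pi>\<^sub>0. z \<in> ?Z"
      unfolding distr_funpow_invariant[OF fm s inv] .
    from measure_support_subset_closure[OF this s] show ?thesis
      by simp
  qed
  moreover have "finite ?F" using R(2) by simp
  ultimately have "spans f n (2 * \<epsilon>) (measure_support \<pi>\<^sub>0) ?F"
    using spans_closure[OF f _ sp1] spans_subset by blast
  then have "r_span f n (2 * \<epsilon>) (measure_support \<pi>\<^sub>0) \<le> card ?F"
    using \<open>finite ?F\<close> by (rule r_span_le[rotated])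
  also have "\<dots> \<le> card ?W"
    using card_image_le[OF R(2)] R(3) order_trans by blast
  finally show ?thesis
    by (simp add: card_PiE)
qed

lemma span_growth_le_C_eps:
  fixes f :: "'a::metric_space \<Rightarrow> 'a"
  assumes X: "compact (UNIV :: 'a set)" and f: "continuous_on UNIV f"
    and p: "prob_space \<pi>\<^sub>0" and s: "sets \<pi>\<^sub>0 = sets borel"
    and inv: "distr \<pi>\<^sub>0 borel f = \<pi>\<^sub>0"
    and ne: "measure_support \<pi>\<^sub>0 \<noteq> {}" and \<epsilon>: "\<epsilon> > 0"
  shows "span_growth f (measure_support \<pi>\<^sub>0) (2 * \<epsilon>) \<le> C_eps f \<pi>\<^sub>0 \<epsilon>"
  unfolding C_eps_def
proof (rule INF_greatest)
  let ?K = "measure_support \<pi>\<^sub>0"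
  have K: "compact ?K"
    using compact_Int_closed[OF X closed_measure_support] by simp
  fix M assume "M \<in> achievable_alphabets f \<pi>\<^sub>0 \<epsilon>"
  then obtain \<delta> \<gamma> T where M: "finite M" "M \<noteq> {}" "coder M \<delta>"
    and E1: "\<And>t. t \<ge> T \<Longrightarrow>
      measure \<pi>\<^sub>0 {x. dist ((f ^^ t) x) (state_estimate f \<delta> \<gamma> x t) \<le> \<epsilon>} = 1"
    unfolding achievable_alphabets_def achieves_E1_def by blast
  have cM: "card M > 0"
    using M card_gt_0_iff by blast
  \<comment> \<open>The offset \<open>T\<close> does not depend on \<open>n\<close>, so
    \<open>(T + n) / n\<close> tends to 1 and the start-up phase leaves no trace in the growth
    rate.\<close>
  let ?b = "\<lambda>n. 1 / real n * (real (T + n) * log 2 (card M))"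
  have "1 / real n * log 2 (real (r_span f n (2 * \<epsilon>) ?K)) \<le> ?b n" for n
  proof (intro mult_left_mono)
    have "real (r_span f n (2 * \<epsilon>) ?K) \<le> real (card M) ^ (T + n)"
      unfolding of_nat_power[symmetric] of_nat_le_iff
      by (rule r_span_le_words[OF f p s inv M(1,3) E1])
    moreover have "r_span f n (2 * \<epsilon>) ?K > 0"
      by (rule r_span_pos[OF f K _ ne]) (use \<epsilon> in simp)
    ultimately have "log 2 (real (r_span f n (2 * \<epsilon>) ?K)) \<le> log 2 (real (card M) ^ (T + n))"
      using cM by simp
    also have "\<dots> = real (T + n) * log 2 (card M)"
      using cM by (simp add: log_nat_power)
    finally show "log 2 (real (r_span f n (2 * \<epsilon>) ?K)) \<le> real (T + n) * log 2 (card M)" .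
  qed simp
  then have "span_growth f ?K (2 * \<epsilon>) \<le> limsup (\<lambda>n. ereal (?b n))"
    unfolding span_growth_def by (intro Limsup_mono always_eventually) simp
  also have "limsup (\<lambda>n. ereal (?b n)) = ereal (log 2 (card M))"
  proof (intro lim_imp_Limsup tendsto_ereal)
    have "(\<lambda>n. (real T / real n + 1) * log 2 (card M)) \<longlonglongrightarrow> (0 + 1) * log 2 (card M)"
      by (intro tendsto_intros lim_const_over_n)
    moreover have "\<forall>\<^sub>F n in sequentially. (real T / real n + 1) * log 2 (card M) = ?b n"
      using eventually_gt_at_top[of 0] by eventually_elim (simp add: field_simps)
    ultimately show "?b \<longlonglongrightarrow> log 2 (card M)"
      using Lim_transform_eventually by fastforce
  qed simp
  finally show "span_growth f ?K (2 * \<epsilon>) \<le> ereal (log 2 (card M))" .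
qed

section \<open>Upper bound\<close>

text \<open>First match along an enumeration of \<open>F\<close>: each induction step puts one more
  measurable test in front. Outside all the sets \<open>B y\<close> the value is merely some default
  element of \<open>F\<close>.\<close>

lemma finite_measurable_selection:
  assumes "finite F" "F \<noteq> {}" "\<And>y. y \<in> F \<Longrightarrow> B y \<in> sets N" "space N = UNIV"
  shows "\<exists>c. c \<in> N \<rightarrow>\<^sub>M count_space F \<and> (\<forall>y\<in>F. \<forall>x\<in>B y. x \<in> B (c x))"
  using assms
proof (induction F rule: finite_ne_induct)
  case (singleton a)
  then show ?case
    by (intro exI[of _ "\<lambda>_. a"] conjI measurable_const) auto
next
  case (insert a F)
  then obtain c where c: "c \<in> N \<rightarrow>\<^sub>M count_space F" "\<forall>y\<in>F. \<forall>x\<in>B y. x \<in> B (c x)"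
    using insert.IH[OF insert.prems(1,2)] by blast
  have "c \<in> N \<rightarrow>\<^sub>M count_space (insert a F)"
    using measurable_compose[OF c(1), of id "count_space (insert a F)"] by auto
  moreover have "B a \<in> sets N" using insert.prems by blast
  ultimately have "(\<lambda>x. if x \<in> B a then a else c x) \<in> N \<rightarrow>\<^sub>M count_space (insert a F)"
    using insert.prems by (intro measurable_If) auto
  then show ?case
    using c(2) by (intro exI[of _ "\<lambda>x. if x \<in> B a then a else c x"]) auto
qed

text \<open>The bound on \<open>card F\<close> lets words of length \<open>n\<close> name the points
  of \<open>F\<close> injectively. A name sent during one block is complete when the next begins; by
  invariance, the state at that moment almost surely lies in \<open>K\<close> and is shadowed by the
  named point.\<close>

lemma block_code_achieves_E1:
  fixes f :: "'a::metric_space \<Rightarrow> 'a"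
  assumes f: "continuous_on UNIV f" and p: "prob_space \<pi>\<^sub>0" and s: "sets \<pi>\<^sub>0 = sets borel"
    and inv: "distr \<pi>\<^sub>0 borel f = \<pi>\<^sub>0"
    and K: "AE x in \<pi>\<^sub>0. x \<in> K" "K \<noteq> {}"
    and F: "finite F" "spans f n \<epsilon> K F" "card F \<le> card M ^ n" and n: "n > 0"
    and M: "finite M" "M \<noteq> {}"
  shows "M \<in> achievable_alphabets f \<pi>\<^sub>0 \<epsilon>"
proof -
  interpret prob_space \<pi>\<^sub>0 by fact
  have fm: "f \<in> borel \<rightarrow>\<^sub>M borel"
    using f by (rule borel_measurable_continuous_onI)
  have fpm: "f ^^ i \<in> borel \<rightarrow>\<^sub>M borel" for i
    using fm by (rule measurable_compose_n)
  define B where "B y = {x. \<forall>i<n. dist ((f ^^ i) x) ((f ^^ i) y) \<le> \<epsilon>}" for y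
  have "B y \<in> sets borel" for y
  proof -
    have "B y = {x. \<exists>z\<in>{y}. \<forall>i<n. dist ((f ^^ i) x) ((f ^^ i) z) \<le> \<epsilon>}"
      by (simp add: B_def)
    then show ?thesis
      using borel_closed[OF closed_shadowed_set[OF f, of "{y}" n \<epsilon>]] by (simp only: finite.intros)
  qed
  moreover have "F \<noteq> {}"
    using F(2) K(2) by (auto simp: spans_def)
  ultimately obtain c where c: "c \<in> borel \<rightarrow>\<^sub>M count_space F" "\<forall>y\<in>F. \<forall>x\<in>B y. x \<in> B (c x)"
    using finite_measurable_selection[OF F(1) _ _ space_borel, of B] by blast
  have cF: "c x \<in> F" for x
    using measurable_space[OF c(1)] by simp
  have cB: "x \<in> B (c x)" if "x \<in> K" for x
    using F(2) c(2) that unfolding spans_def B_def by blast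
  let ?W = "PiE {..<n} (\<lambda>_. M)"
  have "card F \<le> card ?W"
    using F(3) by (simp add: card_PiE)
  moreover have "finite ?W"
    using M by (intro finite_PiE) auto
  ultimately obtain e where e: "e ` F \<subseteq> ?W" "inj_on e F"
    using card_le_inj[OF F(1)] by blast
  \<comment> \<open>Letter \<open>t mod n\<close> of the name of the point shadowing the orbit from
    time \<open>(t div n + 1) * n\<close>, the start of the next block. Only the initial state
    \<open>w 0\<close> is consulted.\<close>
  define \<delta> :: "nat \<Rightarrow> (nat \<Rightarrow> 'a) \<Rightarrow> nat" where
    "\<delta> t w = e (c ((f ^^ ((t div n + 1) * n)) (w 0))) (t mod n)" for t w
  \<comment> \<open>The previous block is decoded and the resulting point is moved forward to the
    current position in the block. In block 0 the truncated subtraction selects block 0 itself,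
    which gives no guarantee.\<close>
  define \<gamma> :: "nat \<Rightarrow> (nat \<Rightarrow> nat) \<Rightarrow> 'a" where
    "\<gamma> t v = (f ^^ (t mod n)) (inv_into F e (\<lambda>r\<in>{..<n}. v ((t div n - 1) * n + r)))" for t v
  have "coder M \<delta>"
    unfolding coder_def
  proof
    fix t :: nat
    have "(\<lambda>w. w 0) \<in> (\<Pi>\<^sub>M i\<in>{..t}. borel) \<rightarrow>\<^sub>M (borel :: 'a measure)"
      by (rule measurable_component_singleton) simp
    from measurable_compose[OF measurable_compose[OF this fpm] c(1)]
    have "(\<lambda>w. c ((f ^^ ((t div n + 1) * n)) (w 0))) \<in> (\<Pi>\<^sub>M i\<in>{..t}. borel) \<rightarrow>\<^sub>M count_space F" .
    moreover have "(\<lambda>y. e y (t mod n)) \<in> count_space F \<rightarrow>\<^sub>M count_space M"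
      using PiE_mem[OF subsetD[OF e(1) imageI]] n by simp
    ultimately show "\<delta> t \<in> (\<Pi>\<^sub>M i\<in>{..t}. borel) \<rightarrow>\<^sub>M count_space M"
      unfolding \<delta>_def using measurable_compose by blast
  qed
  moreover have "achieves_E1 f \<pi>\<^sub>0 \<epsilon> \<delta> \<gamma>"
    unfolding achieves_E1_def
  proof (intro exI allI impI)
    \<comment> \<open>The threshold is \<open>n\<close>: estimates are reliable as soon as the first
      block has been received. Below, \<open>m\<close> is the start of the current block.\<close>
    fix t :: nat assume "n \<le> t"
    define m where "m = t div n * n"
    have td: "t div n > 0"
      using \<open>n \<le> t\<close> n by (simp add: div_greater_zero_iff)
    then have m: "(t div n - 1 + 1) * n = m"
      by (simp add: m_def)
    have "AE x in distr \<pi>\<^sub>0 borel (f ^^ m). x \<in> K"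
      unfolding distr_funpow_invariant[OF fm s inv] by (rule K(1))
    then have "AE x in \<pi>\<^sub>0. (f ^^ m) x \<in> K"
      by (rule AE_distrD[rotated]) (use fpm s in \<open>simp cong: measurable_cong_sets\<close>)
    then have "AE x in \<pi>\<^sub>0. dist ((f ^^ t) x) (state_estimate f \<delta> \<gamma> x t) \<le> \<epsilon>"
    proof eventually_elim
      fix x assume x: "(f ^^ m) x \<in> K"
      let ?y = "c ((f ^^ m) x)"
      have "(\<lambda>i\<in>{..t}. channel_symbol f \<delta> x i) ((t div n - 1) * n + r) = e ?y r" if "r < n" for r
      proof -
        \<comment> \<open>Even the last letter of the previous block was sent before time
          \<open>m\<close>, hence is available at time \<open>t\<close>.\<close>
        have "(t div n - 1) * n + r < m"
          using that m by (metis add.commute add_less_cancel_left mult_Suc Suc_eq_plus1)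
        then have "(t div n - 1) * n + r \<le> t"
          unfolding m_def by (meson div_times_less_eq_dividend less_imp_le order_trans)
        then show ?thesis
          using that m n by (simp add: channel_symbol_def \<delta>_def)
      qed
      then have "(\<lambda>r\<in>{..<n}. (\<lambda>i\<in>{..t}. channel_symbol f \<delta> x i) ((t div n - 1) * n + r)) = e ?y"
        using e(1) cF[of "(f ^^ m) x"]
        by (intro extensionalityI[of _ "{..<n}"]) (auto simp: PiE_def image_subset_iff)
      then have "state_estimate f \<delta> \<gamma> x t = (f ^^ (t mod n)) ?y"
        unfolding state_estimate_def \<gamma>_def by (simp add: e(2) cF)
      moreover have "(f ^^ t) x = (f ^^ (t mod n)) ((f ^^ m) x)"
        by (metis comp_apply funpow_add m_def mod_div_mult_eq)
      ultimately show "dist ((f ^^ t) x) (state_estimate f \<delta> \<gamma> x t) \<le> \<epsilon>"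
        using cB[OF x] n by (simp add: B_def)
    qed
    then show "measure \<pi>\<^sub>0 {x. dist ((f ^^ t) x) (state_estimate f \<delta> \<gamma> x t) \<le> \<epsilon>} = 1"
      using E1_set_measurable[OF f M(1) \<open>coder M \<delta>\<close>] s by (subst prob_eq_1) auto
  qed
  ultimately show ?thesis
    using M unfolding achievable_alphabets_def by blast
qed

text \<open>The strict inequality for the limsup yields a block length \<open>n\<close> with at most
  \<open>N ^ n\<close> spanning points; a single such \<open>n\<close> suffices for the block code
  over \<open>{..<N}\<close>.\<close>

lemma C_eps_le_log:
  fixes f :: "'a::metric_space \<Rightarrow> 'a"
  assumes f: "continuous_on UNIV f" and p: "prob_space \<pi>\<^sub>0" and s: "sets \<pi>\<^sub>0 = sets borel"
    and inv: "distr \<pi>\<^sub>0 borel f = \<pi>\<^sub>0"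
    and K: "compact K" "AE x in \<pi>\<^sub>0. x \<in> K" "K \<noteq> {}" and \<epsilon>: "\<epsilon> > 0"
    and N: "N > 0" "span_growth f K \<epsilon> < ereal (log 2 (real N))"
  shows "C_eps f \<pi>\<^sub>0 \<epsilon> \<le> ereal (log 2 (real N))"
proof -
  have "\<forall>\<^sub>F n in sequentially. 1 / real n * log 2 (real (r_span f n \<epsilon> K)) < log 2 (real N)"
    using Limsup_lessD[OF N(2)[unfolded span_growth_def]] by simp
  then obtain n where n: "n > 0" "1 / real n * log 2 (real (r_span f n \<epsilon> K)) < log 2 (real N)"
    using eventually_happens'[OF sequentially_bot eventually_conj[OF eventually_gt_at_top[of 0]]]
    by blast
  then have "log 2 (real (r_span f n \<epsilon> K)) < real n * log 2 (real N)"
    by (simp add: field_simps)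
  also have "\<dots> = log 2 (real (N ^ n))"
    using N(1) by (simp add: log_nat_power)
  finally have "real (r_span f n \<epsilon> K) < real (N ^ n)"
    using r_span_pos[OF f K(1) \<epsilon> K(3)] N(1) by (subst (asm) log_less_cancel_iff) auto
  then have le: "r_span f n \<epsilon> K \<le> N ^ n"
    by (simp only: of_nat_less_iff)
  obtain F where F: "finite F" "card F = r_span f n \<epsilon> K" "spans f n \<epsilon> K F"
    using r_span_attained[OF f K(1) \<epsilon>, of n] by blast
  have "{..<N} \<in> achievable_alphabets f \<pi>\<^sub>0 \<epsilon>"
    using block_code_achieves_E1[OF f p s inv K(2,3) F(1,3), of "{..<N}"] F(2) le n(1) N(1)
    by auto
  then show ?thesis
    unfolding C_eps_def by (rule INF_lower2) simp
qed

section \<open>Growth rates at a fixed scale versus the entropy\<close>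

lemma span_growth_nonneg:
  fixes f :: "'a::metric_space \<Rightarrow> 'a"
  assumes "continuous_on UNIV f" "compact K" "\<epsilon> > 0" "K \<noteq> {}"
  shows "0 \<le> span_growth f K \<epsilon>"
proof -
  have "0 \<le> 1 / real n * log 2 (real (r_span f n \<epsilon> K))" for n
    using r_span_pos[OF assms, of n] by (intro mult_nonneg_nonneg) auto
  then have "limsup (\<lambda>n. 0) \<le> span_growth f K \<epsilon>"
    unfolding span_growth_def by (intro Limsup_mono always_eventually) simp
  then show ?thesis
    by (simp add: Limsup_const)
qed

text \<open>Growth rates increase as the scale shrinks, so each is a lower bound for the limit at
  0.\<close>

lemma span_growth_le_h_top:
  fixes f :: "'a::metric_space \<Rightarrow> 'a"
  assumes "continuous_on UNIV f" "compact K" "\<epsilon> > 0"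
  shows "span_growth f K \<epsilon> \<le> h_top f K"
proof (rule tendsto_lowerbound[OF h_top_limit[OF assms(1,2)]])
  show "\<forall>\<^sub>F e in at_right 0. span_growth f K \<epsilon> \<le> span_growth f K e"
    using eventually_at_right_real[OF assms(3)]
    by eventually_elim (auto intro: span_growth_antimono[OF assms(1,2)])
qed simp

section \<open>Passage to the limit of small error\<close>

theorem mainTheorem1:
  fixes f :: "'a::metric_space \<Rightarrow> 'a" and \<pi>\<^sub>0 :: "'a measure"
  assumes "compact (UNIV :: 'a set)"
    and "\<exists>g. homeomorphism UNIV UNIV f g"
    and "prob_space \<pi>\<^sub>0" and "sets \<pi>\<^sub>0 = sets borel"
    and "distr \<pi>\<^sub>0 borel f = \<pi>\<^sub>0"
    and "h_top f (measure_support \<pi>\<^sub>0) < \<infinity>"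
  shows "h_top f (measure_support \<pi>\<^sub>0) \<le> C_zero f \<pi>\<^sub>0 \<and>
    C_zero f \<pi>\<^sub>0 \<le>
      ereal (log 2 (1 + real_of_int \<lfloor>2 powr real_of_ereal (h_top f (measure_support \<pi>\<^sub>0))\<rfloor>))"
proof
  let ?K = "measure_support \<pi>\<^sub>0"
  interpret prob_space \<pi>\<^sub>0 by fact
  have f: "continuous_on UNIV f"
    using assms(2) homeomorphism_cont1 by blast
  have K: "compact ?K"
    using compact_Int_closed[OF assms(1) closed_measure_support] by simp
  have ae: "AE x in \<pi>\<^sub>0. x \<in> ?K"
    using AE_measure_support[OF assms(1,4)] .
  \<comment> \<open>With an empty support, \<open>ae\<close> would make almost every point satisfy
    \<open>False\<close>, impossible for a probability measure.\<close>
  then have ne: "?K \<noteq> {}"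
    by auto
  have C: "(C_eps f \<pi>\<^sub>0 \<longlongrightarrow> C_zero f \<pi>\<^sub>0) (at_right 0)"
    using C_zero_limit[OF f assms(3,4)] .
  show "h_top f ?K \<le> C_zero f \<pi>\<^sub>0"
  proof (rule tendsto_le[OF _ C])
    \<comment> \<open>The factor 2 comes from the triangle inequality through the shared estimate;
      it disappears as the scale tends to 0.\<close>
    have "filterlim (\<lambda>\<epsilon>::real. 2 * \<epsilon>) (at_right 0) (at_right 0)"
      by real_asymp
    then show "((\<lambda>\<epsilon>. span_growth f ?K (2 * \<epsilon>)) \<longlongrightarrow> h_top f ?K) (at_right 0)"
      by (rule filterlim_compose[OF h_top_limit[OF f K]])
    show "\<forall>\<^sub>F \<epsilon> in at_right 0. span_growth f ?K (2 * \<epsilon>) \<le> C_eps f \<pi>\<^sub>0 \<epsilon>"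
      by (rule eventually_mono[OF eventually_at_right_less[of 0]])
        (rule span_growth_le_C_eps[OF assms(1) f assms(3-5) ne])
  qed simp
  \<comment> \<open>The least integer strictly above \<open>2 powr h\<close>, where \<open>h\<close>
    is the entropy. Strictness is what gives \<open>h < log 2 N\<close>, including when
    \<open>2 powr h\<close> is an integer.\<close>
  define N where "N = nat (1 + \<lfloor>2 powr real_of_ereal (h_top f ?K)\<rfloor>)"
  have Nr: "real N = 1 + real_of_int \<lfloor>2 powr real_of_ereal (h_top f ?K)\<rfloor>"
    unfolding N_def by simp
  \<comment> \<open>Excludes the value -\<infinity>. With the finiteness assumption the entropy is
    then a real number, and \<open>real_of_ereal\<close> returns it unchanged.\<close>
  have "0 \<le> h_top f ?K"
    using span_growth_nonneg[OF f K zero_less_one ne] span_growth_le_h_top[OF f K zero_less_one]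
    by (rule order_trans)
  then obtain h where h: "h_top f ?K = ereal h"
    using assms(6) by (cases "h_top f ?K") auto
  have gt: "2 powr h < real N"
    using real_of_int_floor_add_one_gt[of "2 powr h"] unfolding Nr h by (simp only: real_of_ereal.simps add.commute)
  have N0: "N > 0"
    using gt by (auto intro: Nat.gr0I)
  have "h < log 2 (real N)"
    using gt N0 by (simp add: less_log_iff)
  \<comment> \<open>The same \<open>N\<close> works at every scale, so \<open>C_eps\<close> is
    bounded uniformly and the bound survives the limit.\<close>
  then have sg: "span_growth f ?K \<epsilon> < ereal (log 2 (real N))" if "\<epsilon> > 0" for \<epsilon>
    using span_growth_le_h_top[OF f K that] h by (metis le_less_trans less_ereal.simps(1))
  have "C_zero f \<pi>\<^sub>0 \<le> ereal (log 2 (real N))"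
  proof (rule tendsto_upperbound[OF C])
    show "\<forall>\<^sub>F \<epsilon> in at_right 0. C_eps f \<pi>\<^sub>0 \<epsilon> \<le> ereal (log 2 (real N))"
      by (rule eventually_mono[OF eventually_at_right_less[of 0]])
        (rule C_eps_le_log[OF f assms(3-5) K ae ne _ N0 sg])
  qed simp
  then show "C_zero f \<pi>\<^sub>0 \<le>
      ereal (log 2 (1 + real_of_int \<lfloor>2 powr real_of_ereal (h_top f ?K)\<rfloor>))"
    unfolding Nr .
qed

end
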